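(* Every $2$-dimensional pre-Jordan algebra over $\mathbb{C}$ is isomorphic to one of the following (mutually non-isomorphic) pre-Jordan algebras, given by their formal characteristic matrices with respect to a basis $\{e_1,e_2\}$: $$J_{1,1}:\begin{pmatrix} e_1&0\\ 0&e_2\end{pmatrix},\quad J_{1,2}:\begin{pmatrix} e_1&e_2\\ -e_2&e_2\end{pmatrix},\quad J_{2,1}:\begin{pmatrix} e_1&e_2\\ e_2&0\end{pmatrix},\quad J_{2,2}:\begin{pmatrix} e_1&2e_2\\ 0&0\end{pmatrix},$$ $$J_{3,1}:\begin{pmatrix} e_1&0\\ 0&0\end{pmatrix},\quad J_{3,2}:\begin{pmatrix} e_1&e_2\\ -e_2&0\end{pmatrix},\quad J_{4,1}:\begin{pmatrix} e_1&0\\ e_2&0\end{pmatrix},\quad J_{4,2}:\begin{pmatrix} e_1&e_2\\ 0&0\end{pmatrix},$$ $$J_{4,3}:\begin{pmatrix} e_1&2e_2\\ -e_2&0\end{pmatrix},\quad J_{5,1}:\begin{pmatrix} e_2&0\\ 0&0\end{pmatrix},\quad J_{6,1}:\begin{pmatrix} 0&0\\ 0&0\end{pmatrix}.$$ Moreover, $J_{1,1}$, $J_{2,1}$, $J_{3,1}$, $J_{5,1}$ and $J_{6,1}$ are commutative and associative, and $J_{4,1}$ and $J_{4,2}$ are associative.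
   Context: All vector spaces and algebras are over $\mathbb{C}$. A pre-Jordan algebra is a vector space $A$ with a bilinear multiplication $\cdot:A\times A\to A$ such that, writing $x\circ y:=x\cdot y+y\cdot x$, for all $x,y,z,u\in A$: $$(x\circ y)\cdot(z\cdot u)+(y\circ z)\cdot(x\cdot u)+(z\circ x)\cdot(y\cdot u)$$ $$= x\cdot(y\cdot(z\cdot u))+z\cdot(y\cdot(x\cdot u))+((x\circ z)\circ y)\cdot u$$ $$= z\cdot((x\circ y)\cdot u)+x\cdot((y\circ z)\cdot u)+y\cdot((z\circ x)\cdot u).$$ An isomorphism of pre-Jordan algebras is a bijective linear map preserving the multiplications. The formal characteristic matrix of an algebra with basis $\{e_1,\dots,e_N\}$ is the $N\times N$ matrix whose $(i,j)$ entry is the product $e_i\cdot e_j$; it determines the algebra. *)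

theory Defs
  imports "HOL-Analysis.Analysis"
begin

definition circ :: "('a::ab_group_add \<Rightarrow> 'a \<Rightarrow> 'a) \<Rightarrow> 'a \<Rightarrow> 'a \<Rightarrow> 'a" where
  "circ mul x y = mul x y + mul y x"

text \<open>The underlying vector space is the whole type \<open>'a\<close>, with an arbitrary complex scalar
  multiplication \<open>scale\<close>.\<close>

locale pre_jordan_algebra = vector_space scale
  for scale :: "complex \<Rightarrow> 'a::ab_group_add \<Rightarrow> 'a" +
  fixes mul :: "'a \<Rightarrow> 'a \<Rightarrow> 'a"  (infixl \<open>\<cdot>\<close> 70)
  assumes linear_right: "Vector_Spaces.linear scale scale (\<lambda>y. x \<cdot> y)"
    and linear_left: "Vector_Spaces.linear scale scale (\<lambda>x. x \<cdot> y)"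
    and pre_jordan1:
      "circ mul x y \<cdot> (z \<cdot> u) + circ mul y z \<cdot> (x \<cdot> u) + circ mul z x \<cdot> (y \<cdot> u)
       = x \<cdot> (y \<cdot> (z \<cdot> u)) + z \<cdot> (y \<cdot> (x \<cdot> u)) + circ mul (circ mul x z) y \<cdot> u"
    and pre_jordan2:
      "x \<cdot> (y \<cdot> (z \<cdot> u)) + z \<cdot> (y \<cdot> (x \<cdot> u)) + circ mul (circ mul x z) y \<cdot> u
       = z \<cdot> (circ mul x y \<cdot> u) + x \<cdot> (circ mul y z \<cdot> u) + y \<cdot> (circ mul z x \<cdot> u)"

definition algebra_isomorphism ::
  "(complex \<Rightarrow> 'a::ab_group_add \<Rightarrow> 'a) \<Rightarrow> ('a \<Rightarrow> 'a \<Rightarrow> 'a) \<Rightarrow>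
   (complex \<Rightarrow> 'b::ab_group_add \<Rightarrow> 'b) \<Rightarrow> ('b \<Rightarrow> 'b \<Rightarrow> 'b) \<Rightarrow> ('a \<Rightarrow> 'b) \<Rightarrow> bool" where
  "algebra_isomorphism scale1 mul1 scale2 mul2 f \<longleftrightarrow>
     Vector_Spaces.linear scale1 scale2 f \<and> bij f \<and> (\<forall>x y. f (mul1 x y) = mul2 (f x) (f y))"

definition isomorphic_algebras ::
  "(complex \<Rightarrow> 'a::ab_group_add \<Rightarrow> 'a) \<Rightarrow> ('a \<Rightarrow> 'a \<Rightarrow> 'a) \<Rightarrow>
   (complex \<Rightarrow> 'b::ab_group_add \<Rightarrow> 'b) \<Rightarrow> ('b \<Rightarrow> 'b \<Rightarrow> 'b) \<Rightarrow> bool" where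
  "isomorphic_algebras scale1 mul1 scale2 mul2 \<longleftrightarrow>
     (\<exists>f. algebra_isomorphism scale1 mul1 scale2 mul2 f)"

definition formal_char_matrix :: "('a \<Rightarrow> 'a \<Rightarrow> 'a) \<Rightarrow> ('n \<Rightarrow> 'a) \<Rightarrow> 'a ^ 'n ^ 'n" where
  "formal_char_matrix mul e = (\<chi> i j. mul (e i) (e j))"

text \<open>The bilinear multiplication on \<open>\<complex>\<^sup>n\<close> whose formal characteristic matrix with respect to the
  standard basis is \<open>M\<close>; see the two lemmas below.\<close>

definition mult_of_matrix ::
  "(complex ^ 'n) ^ 'n ^ 'n \<Rightarrow> complex ^ 'n \<Rightarrow> complex ^ 'n \<Rightarrow> complex ^ 'n" where
  "mult_of_matrix M x y = (\<Sum>i\<in>UNIV. \<Sum>j\<in>UNIV. (x $ i * y $ j) *s (M $ i $ j))"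

lemma formal_char_matrix_mult_of_matrix:
  "formal_char_matrix (mult_of_matrix M) (\<lambda>i. axis i 1) = M"
proof -
  have "mult_of_matrix M (axis i 1) (axis j 1) = M $ i $ j" for i j
  proof -
    have "mult_of_matrix M (axis i 1) (axis j 1)
        = (\<Sum>i'\<in>UNIV. \<Sum>j'\<in>UNIV. if j' = j then if i' = i then M $ i' $ j' else 0 else 0)"
      unfolding mult_of_matrix_def by (intro sum.cong refl) (auto simp: axis_def)
    then show ?thesis by simp
  qed
  then show ?thesis by (simp add: formal_char_matrix_def vec_eq_iff)
qed

lemma mult_of_matrix_formal_char_matrix:
  fixes mul :: "complex ^ 'n \<Rightarrow> complex ^ 'n \<Rightarrow> complex ^ 'n"
  assumes r: "\<And>x. Vector_Spaces.linear (*s) (*s) (\<lambda>y. mul x y)"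
    and l: "\<And>y. Vector_Spaces.linear (*s) (*s) (\<lambda>x. mul x y)"
  shows "mult_of_matrix (formal_char_matrix mul (\<lambda>i. axis i 1)) = mul"
proof (intro ext)
  fix x y :: "complex ^ 'n"
  have "mul x y = mul (\<Sum>i\<in>UNIV. (x $ i) *s axis i 1) y"
    by (simp add: basis_expansion)
  also have "\<dots> = (\<Sum>i\<in>UNIV. (x $ i) *s mul (axis i 1) y)"
    by (simp add: module_hom.sum[OF l[folded module_hom_iff_linear]] module_hom.scale[OF l[folded module_hom_iff_linear]])
  also have "\<dots> = (\<Sum>i\<in>UNIV. (x $ i) *s mul (axis i 1) (\<Sum>j\<in>UNIV. (y $ j) *s axis j 1))"
    by (simp add: basis_expansion)
  also have "\<dots> = mult_of_matrix (formal_char_matrix mul (\<lambda>i. axis i 1)) x y"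
    by (simp add: module_hom.sum[OF r[folded module_hom_iff_linear]] module_hom.scale[OF r[folded module_hom_iff_linear]]
        vec.scale_sum_right mult_of_matrix_def formal_char_matrix_def)
  finally show "mult_of_matrix (formal_char_matrix mul (\<lambda>i. axis i 1)) x y = mul x y" ..
qed

datatype J_label = J11 | J12 | J21 | J22 | J31 | J32 | J41 | J42 | J43 | J51 | J61

abbreviation e1 :: "complex ^ 2" where "e1 \<equiv> axis 1 1"
abbreviation e2 :: "complex ^ 2" where "e2 \<equiv> axis 2 1"

abbreviation mat22 :: "'a::zero \<Rightarrow> 'a \<Rightarrow> 'a \<Rightarrow> 'a \<Rightarrow> 'a ^ 2 ^ 2" where
  "mat22 a b c d \<equiv> vector [vector [a, b], vector [c, d]]"

fun J_matrix :: "J_label \<Rightarrow> (complex ^ 2) ^ 2 ^ 2" where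
  "J_matrix J11 = mat22 e1 0 0 e2"
| "J_matrix J12 = mat22 e1 e2 (- e2) e2"
| "J_matrix J21 = mat22 e1 e2 e2 0"
| "J_matrix J22 = mat22 e1 (2 *s e2) 0 0"
| "J_matrix J31 = mat22 e1 0 0 0"
| "J_matrix J32 = mat22 e1 e2 (- e2) 0"
| "J_matrix J41 = mat22 e1 0 e2 0"
| "J_matrix J42 = mat22 e1 e2 0 0"
| "J_matrix J43 = mat22 e1 (2 *s e2) (- e2) 0"
| "J_matrix J51 = mat22 e2 0 0 0"
| "J_matrix J61 = mat22 0 0 0 0"

definition J_mult :: "J_label \<Rightarrow> complex ^ 2 \<Rightarrow> complex ^ 2 \<Rightarrow> complex ^ 2" where
  "J_mult l = mult_of_matrix (J_matrix l)"

end

theory Submission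
  imports Defs "HOL-Computational_Algebra.Fundamental_Theorem_Algebra"
begin

text \<open>
  The classification rests on one vector.  Squaring is a quadratic map of the plane, so looking for
  \<open>e \<noteq> 0\<close> with \<open>e \<cdot> e\<close> a multiple \<open>c e\<close> means finding a zero of a binary cubic form, which exists
  over \<open>\<complex>\<close> (\<open>square_eigenline\<close>).  If \<open>c \<noteq> 0\<close>, rescaling makes \<open>e\<close> idempotent.

  For an idempotent \<open>e\<close> the pre-Jordan identities with \<open>x = y = z = e\<close> say that the left
  multiplication \<open>L = L\<^sub>e\<close> satisfies \<open>L (L - 1) (L - 2) = 0\<close>.  The polynomial has simple roots, so
  \<open>e\<close> extends to a basis \<open>e, w\<close> of eigenvectors of \<open>L\<close> (\<open>left_eigenbasis\<close>).  This is the left half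
  of a Peirce decomposition; the right half asks for the coefficient \<open>d\<close> of \<open>w\<close> in \<open>w \<cdot> e\<close>, and
  only seven pairs of an eigenvalue \<open>b\<close> and a coefficient \<open>d\<close> survive the identities
  (\<open>peirce_types\<close>).  For each pair the identities on basis vectors fix the remaining structure
  constants, up to one or two parameters that a further change of basis normalises.

  If \<open>c = 0\<close>, the identities make both \<open>e \<cdot> w\<close> and \<open>w \<cdot> e\<close> multiples of \<open>e\<close>, and the coefficient \<open>q\<close> of
  \<open>w\<close> in \<open>w \<cdot> w\<close> decides: if \<open>q \<noteq> 0\<close>, some \<open>w + s e\<close> is a multiple of an idempotent, and otherwise
  \<open>w \<cdot> w\<close> is the only product that can be nonzero (\<open>square_zero_dichotomy\<close>).

  That the eleven algebras satisfy the identities is a computation in coordinates.  They are told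
  apart by seven properties that isomorphisms preserve, such as having a left unit or being
  commutative (\<open>invariants_J\<close>).
\<close>

section \<open>The eleven algebras\<close>

lemma axis_2:
  "e1 $ 1 = 1" "e1 $ 2 = 0" "e2 $ 1 = 0" "e2 $ 2 = 1"
  by (simp_all add: axis_def)

lemma mult_of_matrix_2:
  fixes M :: "(complex ^ 2) ^ 2 ^ 2"
  shows "mult_of_matrix M x y $ k =
      x $ 1 * y $ 1 * M $ 1 $ 1 $ k + x $ 1 * y $ 2 * M $ 1 $ 2 $ k +
      x $ 2 * y $ 1 * M $ 2 $ 1 $ k + x $ 2 * y $ 2 * M $ 2 $ 2 $ k"
  by (simp add: mult_of_matrix_def sum_2)

lemmas J_coords = J_mult_def mult_of_matrix_2 axis_2 vec_eq_iff forall_2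

lemma linear_mult_of_matrix:
  fixes M :: "(complex ^ 2) ^ 2 ^ 2"
  shows "Vector_Spaces.linear (*s) (*s) (\<lambda>y. mult_of_matrix M x y)"
    and "Vector_Spaces.linear (*s) (*s) (\<lambda>x. mult_of_matrix M x y)"
  by (simp_all add: Vector_Spaces.linear_iff vec.vector_space_axioms vec_eq_iff mult_of_matrix_2
      distrib_left distrib_right add_ac mult_ac)

lemma pre_jordan_J: "pre_jordan_algebra (*s) (J_mult l)"
proof (intro pre_jordan_algebra.intro pre_jordan_algebra_axioms.intro vec.vector_space_axioms)
  fix x y z u
  let ?m = "J_mult l"
  show "?m (circ ?m x y) (?m z u) + ?m (circ ?m y z) (?m x u) + ?m (circ ?m z x) (?m y u)
      = ?m x (?m y (?m z u)) + ?m z (?m y (?m x u)) + ?m (circ ?m (circ ?m x z) y) u"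
    by (cases l) (simp_all add: circ_def J_coords, simp_all add: algebra_simps)
  show "?m x (?m y (?m z u)) + ?m z (?m y (?m x u)) + ?m (circ ?m (circ ?m x z) y) u
      = ?m z (?m (circ ?m x y) u) + ?m x (?m (circ ?m y z) u) + ?m y (?m (circ ?m z x) u)"
    by (cases l) (simp_all add: circ_def J_coords, simp_all add: algebra_simps)
qed (simp_all only: J_mult_def linear_mult_of_matrix)

lemma associative_J:
  assumes "l \<in> {J11, J21, J31, J41, J42, J51, J61}"
  shows "semigroup (J_mult l)"
  using assms by unfold_locales (auto simp: J_coords algebra_simps)

lemma commutative_associative_J:
  assumes "l \<in> {J11, J21, J31, J51, J61}"
  shows "abel_semigroup (J_mult l)"
proof (rule abel_semigroup.intro)
  show "semigroup (J_mult l)" using assms by (intro associative_J) auto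
  show "abel_semigroup_axioms (J_mult l)"
    using assms by unfold_locales (auto simp: J_coords algebra_simps)
qed

section \<open>The eleven algebras are pairwise non-isomorphic\<close>

text \<open>A list instead of separate predicates, so that two algebras are told apart by comparing constants.  The
  entries are chosen to separate all eleven algebras.\<close>

definition invariants :: "('a::zero \<Rightarrow> 'a \<Rightarrow> 'a) \<Rightarrow> bool list" where
  "invariants m =
    [\<exists>u. \<forall>x. m u x = x,
     \<exists>u. \<forall>x. m x u = x,
     \<forall>x y. m x y = m y x,
     \<exists>x. x \<noteq> 0 \<and> m x x = 0,
     \<exists>x. x \<noteq> 0 \<and> (\<forall>y. m x y = 0),
     \<exists>x. x \<noteq> 0 \<and> m x x = x,
     \<forall>x y. m x y = 0]"

lemma invariants_eq_if_isomorphic: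
  assumes "isomorphic_algebras s1 m1 s2 m2"
  shows "invariants m1 = invariants m2"
proof -
  obtain f where lin: "Vector_Spaces.linear s1 s2 f" and "bij f"
    and hom: "\<And>x y. f (m1 x y) = m2 (f x) (f y)"
    using assms by (auto simp: isomorphic_algebras_def algebra_isomorphism_def)
  have inj: "f x = f y \<longleftrightarrow> x = y" for x y
    using \<open>bij f\<close> by (simp add: bij_is_inj inj_eq)
  have f0: "f x = 0 \<longleftrightarrow> x = 0" for x
    using inj module_hom.zero[OF lin[folded module_hom_iff_linear]] by metis
  have f_inv: "f (inv f y) = y" for y
    using bij_is_surj[OF \<open>bij f\<close>] by (rule surj_f_inv_f)
  have all: "(\<forall>y. P y) \<longleftrightarrow> (\<forall>x. P (f x))" and ex: "(\<exists>y. P y) \<longleftrightarrow> (\<exists>x. P (f x))" for P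
    using bij_is_surj[OF \<open>bij f\<close>] by (metis surj_def)+
  have
    "(\<exists>u. \<forall>x. m2 u x = x) \<longleftrightarrow> (\<exists>u. \<forall>x. m1 u x = x)"
    "(\<exists>u. \<forall>x. m2 x u = x) \<longleftrightarrow> (\<exists>u. \<forall>x. m1 x u = x)"
    "(\<exists>x. x \<noteq> 0 \<and> (\<forall>y. m2 x y = 0)) \<longleftrightarrow> (\<exists>x. x \<noteq> 0 \<and> (\<forall>y. m1 x y = 0))"
    by (subst ex, subst all, simp add: inj f0 flip: hom)+
  moreover have
    "(\<forall>x y. m2 x y = m2 y x) \<longleftrightarrow> (\<forall>x y. m1 x y = m1 y x)"
    "(\<forall>x y. m2 x y = 0) \<longleftrightarrow> (\<forall>x y. m1 x y = 0)"
    using f_inv inj f0 hom by metis+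
  moreover have
    "(\<exists>x. x \<noteq> 0 \<and> m2 x x = 0) \<longleftrightarrow> (\<exists>x. x \<noteq> 0 \<and> m1 x x = 0)"
    "(\<exists>x. x \<noteq> 0 \<and> m2 x x = x) \<longleftrightarrow> (\<exists>x. x \<noteq> 0 \<and> m1 x x = x)"
    by (subst ex, simp add: inj f0 flip: hom)+
  ultimately show ?thesis unfolding invariants_def by (simp only:)
qed

lemma ex_vec2: "(\<exists>x :: complex ^ 2. P x) \<longleftrightarrow> (\<exists>a b. P (vector [a, b]))"
proof -
  have "x = vector [x $ 1, x $ 2]" for x :: "complex ^ 2"
    by (simp add: vec_eq_iff forall_2)
  then show ?thesis by metis
qed

text \<open>By bilinearity it is enough to test the unit, annihilator and commutativity conditions on basis
  vectors.  This turns their quantifiers over the plane into a few equations, which leaves only the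
  existence of \<open>x\<close> to be decided.\<close>

lemma left_unit_iff:
  "(\<forall>y. J_mult l x y = y) \<longleftrightarrow> J_mult l x e1 = e1 \<and> J_mult l x e2 = e2"
  (is "?L \<longleftrightarrow> ?R")
proof
  assume ?R
  then show ?L by (auto simp: J_coords) algebra+
qed auto

lemma right_unit_iff:
  "(\<forall>y. J_mult l y x = y) \<longleftrightarrow> J_mult l e1 x = e1 \<and> J_mult l e2 x = e2"
  (is "?L \<longleftrightarrow> ?R")
proof
  assume ?R
  then show ?L by (auto simp: J_coords) algebra+
qed auto

lemma left_annihilator_iff:
  "(\<forall>y. J_mult l x y = 0) \<longleftrightarrow> J_mult l x e1 = 0 \<and> J_mult l x e2 = 0"
  (is "?L \<longleftrightarrow> ?R")
proof
  assume ?R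
  then show ?L by (auto simp: J_coords) algebra+
qed auto

lemma zero_iff:
  "(\<forall>x y. J_mult l x y = 0) \<longleftrightarrow> l = J61"
  (is "?L \<longleftrightarrow> ?R")
proof
  assume ?L
  then have "J_mult l e1 e1 = 0" "J_mult l e2 e2 = 0" by auto
  then show ?R by (cases l) (auto simp: J_coords)
qed (simp add: J_coords)

lemma commutative_iff:
  "(\<forall>x y. J_mult l x y = J_mult l y x) \<longleftrightarrow> J_mult l e1 e2 = J_mult l e2 e1"
  (is "?L \<longleftrightarrow> ?R")
proof
  assume ?R
  then show ?L by (auto simp: J_coords)
qed auto

lemma idempotent_iff:
  "(\<exists>x. x \<noteq> 0 \<and> J_mult l x x = x) \<longleftrightarrow> l \<noteq> J51 \<and> l \<noteq> J61"
  (is "?L \<longleftrightarrow> ?R")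
proof
  assume ?R
  then have "J_mult l e1 e1 = e1" by (cases l) (simp_all add: J_coords)
  then show ?L by (intro exI[of _ e1]) (simp add: axis_eq_0_iff)
qed (auto simp: J_coords)

text \<open>In the table, \<open>J12\<close>, \<open>J32\<close> and \<open>J42\<close> all have a left unit only; they differ by the square-zero and
  annihilator conditions.  \<open>J31\<close>, \<open>J51\<close> and \<open>J61\<close> are commutative without a unit and need the last two
  entries.\<close>

lemma invariants_J:
  "invariants (J_mult l) = (case l of
     J11 \<Rightarrow> [True, True, True, False, False, True, False]
   | J21 \<Rightarrow> [True, True, True, True, False, True, False]
   | J12 \<Rightarrow> [True, False, False, False, False, True, False]
   | J32 \<Rightarrow> [True, False, False, True, False, True, False]
   | J42 \<Rightarrow> [True, False, False, True, True, True, False]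
   | J41 \<Rightarrow> [False, True, False, True, False, True, False]
   | J22 \<Rightarrow> [False, False, False, True, True, True, False]
   | J43 \<Rightarrow> [False, False, False, True, False, True, False]
   | J31 \<Rightarrow> [False, False, True, True, True, True, False]
   | J51 \<Rightarrow> [False, False, True, True, True, False, False]
   | J61 \<Rightarrow> [False, False, True, True, True, False, True])"
proof -
  have nonzero: "\<exists>a :: complex. a \<noteq> 0" by (rule exI[of _ 1]) simp
  show ?thesis
    unfolding invariants_def zero_iff left_unit_iff right_unit_iff left_annihilator_iff
      commutative_iff idempotent_iff
    by (cases l) (simp_all add: J_coords ex_vec2 nonzero)
qed

lemma not_isomorphic_J:
  assumes "l \<noteq> l'"
  shows "\<not> isomorphic_algebras (*s) (J_mult l) (*s) (J_mult l')"
proof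
  assume "isomorphic_algebras (*s) (J_mult l) (*s) (J_mult l')"
  then have "invariants (J_mult l) = invariants (J_mult l')"
    by (rule invariants_eq_if_isomorphic)
  then show False
    using assms by (cases l; cases l'; simp add: invariants_J)
qed

section \<open>Bases and multiplication tables\<close>

context pre_jordan_algebra
begin

lemmas mul_bilinear =
  module_hom.add[OF linear_left[folded module_hom_iff_linear]]
  module_hom.add[OF linear_right[folded module_hom_iff_linear]]
  module_hom.scale[OF linear_left[folded module_hom_iff_linear]]
  module_hom.scale[OF linear_right[folded module_hom_iff_linear]]

text \<open>The identities are evaluated on coordinate vectors.  Keeping \<open>comb\<close> an opaque constant stops the
  simplifier from expanding these vectors, so that products and sums stay in normal form and an
  identity becomes a pair of equations between structure constants.\<close>

definition comb :: "'a \<Rightarrow> 'a \<Rightarrow> complex \<Rightarrow> complex \<Rightarrow> 'a" where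
  "comb e w s t = scale s e + scale t w"

definition ordered_basis :: "'a \<Rightarrow> 'a \<Rightarrow> bool" where
  "ordered_basis e w \<longleftrightarrow>
     (\<forall>x. \<exists>s t. x = comb e w s t) \<and> (\<forall>s t. comb e w s t = 0 \<longrightarrow> s = 0 \<and> t = 0)"

text \<open>The four entries of the formal characteristic matrix of the basis \<open>e, w\<close>, row by row, each by its
  coefficients \<open>a\<^sub>i\<close> of \<open>e\<close> and \<open>b\<^sub>i\<close> of \<open>w\<close>.\<close>

definition table ::
  "'a \<Rightarrow> 'a \<Rightarrow> complex \<Rightarrow> complex \<Rightarrow> complex \<Rightarrow> complex \<Rightarrow> complex \<Rightarrow> complex \<Rightarrow> complex \<Rightarrow> complex
    \<Rightarrow> bool" where
  "table e w a1 b1 a2 b2 a3 b3 a4 b4 \<longleftrightarrow> ordered_basis e w \<and>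
     e \<cdot> e = comb e w a1 b1 \<and> e \<cdot> w = comb e w a2 b2 \<and>
     w \<cdot> e = comb e w a3 b3 \<and> w \<cdot> w = comb e w a4 b4"

lemma comb_add: "comb e w s t + comb e w s' t' = comb e w (s + s') (t + t')"
  by (simp add: comb_def algebra_simps)

lemma comb_scale: "scale k (comb e w s t) = comb e w (k * s) (k * t)"
  by (simp add: comb_def algebra_simps)

lemma comb_unit: "comb e w 1 0 = e" "comb e w 0 1 = w" "comb e w 0 0 = 0"
  by (simp_all add: comb_def)

lemma comb_comb:
  "comb (comb e w s t) (comb e w s' t') x y = comb e w (x * s + y * s') (x * t + y * t')"
  by (simp add: comb_def algebra_simps)

lemma comb_eq_iff:
  assumes "ordered_basis e w"
  shows "comb e w s t = comb e w s' t' \<longleftrightarrow> s = s' \<and> t = t'"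
proof
  assume "comb e w s t = comb e w s' t'"
  then have "comb e w (s - s') (t - t') = 0"
    by (simp add: comb_def algebra_simps)
  then show "s = s' \<and> t = t'"
    using assms by (force simp: ordered_basis_def)
qed auto

lemma ordered_basis_change:
  assumes B: "ordered_basis e w" and det: "s * t' - t * s' \<noteq> 0"
  shows "ordered_basis (comb e w s t) (comb e w s' t')"
  unfolding ordered_basis_def comb_comb
proof (intro conjI allI impI)
  fix x
  obtain a b where x: "x = comb e w a b"
    using B unfolding ordered_basis_def by blast
  define d where "d = s * t' - t * s'"
  have d: "d \<noteq> 0" using det by (simp add: d_def)
  \<comment> \<open>Cramer's rule.\<close>
  have "x = comb e w ((a * t' - b * s') / d * s + (b * s - a * t) / d * s')
                     ((a * t' - b * s') / d * t + (b * s - a * t) / d * t')"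
    unfolding x comb_eq_iff[OF B] using d by (simp add: field_simps) (simp add: d_def algebra_simps)
  then show "\<exists>a b. x = comb e w (a * s + b * s') (a * t + b * t')" by blast
next
  fix a b assume "comb e w (a * s + b * s') (a * t + b * t') = 0"
  then have "a * s + b * s' = 0" "a * t + b * t' = 0"
    using B by (auto simp: ordered_basis_def)
  then have "a * (s * t' - t * s') = 0" "b * (s * t' - t * s') = 0" by algebra+
  then show "a = 0" "b = 0" using det by auto
qed

lemma table_basis: "table e w a1 b1 a2 b2 a3 b3 a4 b4 \<Longrightarrow> ordered_basis e w"
  by (simp add: table_def)

lemma mul_comb:
  assumes "table e w a1 b1 a2 b2 a3 b3 a4 b4"
  shows "comb e w s t \<cdot> comb e w s' t'
       = comb e w (s * s' * a1 + s * t' * a2 + t * s' * a3 + t * t' * a4)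
                  (s * s' * b1 + s * t' * b2 + t * s' * b3 + t * t' * b4)"
proof -
  have "comb e w s t \<cdot> comb e w s' t'
      = scale (s * s') (e \<cdot> e) + scale (s * t') (e \<cdot> w)
        + (scale (t * s') (w \<cdot> e) + scale (t * t') (w \<cdot> w))"
    by (simp add: comb_def mul_bilinear scale_right_distrib mult.commute add_ac)
  then show ?thesis
    using assms by (simp add: table_def comb_scale comb_add algebra_simps)
qed

lemma ex_table:
  assumes "ordered_basis e w"
  shows "\<exists>a1 b1 a2 b2 a3 b3 a4 b4. table e w a1 b1 a2 b2 a3 b3 a4 b4"
  using assms unfolding table_def ordered_basis_def by metis

lemma ex_ordered_basis:
  assumes "dim UNIV = 2"
  shows "\<exists>e w. ordered_basis e w"
proof -
  obtain B where B: "independent B" "UNIV \<subseteq> span B" "card B = 2"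
    using basis_exists[of UNIV] assms by metis
  then obtain e w where ew: "B = {e, w}" "e \<noteq> w" by (auto simp: card_2_iff)
  have "\<exists>s t. x = comb e w s t" for x
  proof -
    have "x \<in> span {e, w}" using B ew by auto
    then show ?thesis
      by (auto simp: span_insert comb_def span_singleton algebra_simps)
  qed
  moreover have "s = 0 \<and> t = 0" if "comb e w s t = 0" for s t
  proof -
    let ?u = "\<lambda>v. if v = e then s else t"
    have "(\<Sum>v\<in>{e, w}. scale (?u v) v) = 0"
      using that ew by (simp add: comb_def)
    then have "\<forall>v\<in>{e, w}. ?u v = 0"
      using B(1) ew(1) independentD[of "{e, w}" "{e, w}" ?u] by auto
    then show ?thesis using ew(2) by auto
  qed
  ultimately show ?thesis unfolding ordered_basis_def by blast
qed

text \<open>The coordinate map of a basis with the table of \<open>J\<close> is an isomorphism, so recognising an algebra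
  amounts to exhibiting a suitable basis.\<close>

lemma isomorphic_if_table:
  assumes T: "table e w (J_matrix l $ 1 $ 1 $ 1) (J_matrix l $ 1 $ 1 $ 2)
                        (J_matrix l $ 1 $ 2 $ 1) (J_matrix l $ 1 $ 2 $ 2)
                        (J_matrix l $ 2 $ 1 $ 1) (J_matrix l $ 2 $ 1 $ 2)
                        (J_matrix l $ 2 $ 2 $ 1) (J_matrix l $ 2 $ 2 $ 2)"
  shows "isomorphic_algebras scale mul (*s) (J_mult l)"
proof -
  define g :: "complex ^ 2 \<Rightarrow> 'a" where "g v = comb e w (v $ 1) (v $ 2)" for v
  have B: "ordered_basis e w" using T by (simp add: table_def)
  have "bij g"
  proof (rule bijI)
    show "inj g"
      by (rule injI) (simp add: g_def comb_eq_iff[OF B] vec_eq_iff forall_2)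
    show "surj g"
    proof (unfold surj_def, intro allI)
      fix x
      obtain s t where "x = comb e w s t" using B unfolding ordered_basis_def by blast
      then have "g (vector [s, t]) = x" by (simp add: g_def)
      then show "\<exists>v. x = g v" by blast
    qed
  qed
  have g_mult: "g (J_mult l x y) = g x \<cdot> g y" for x y
    by (simp add: g_def mul_comb[OF T] comb_eq_iff[OF B] J_mult_def mult_of_matrix_def sum_2 algebra_simps)
  have f_g: "inv g (g v) = v" and g_f: "g (inv g x) = x" for v x
    using \<open>bij g\<close> by (simp_all add: bij_is_inj bij_is_surj surj_f_inv_f)
  have "Vector_Spaces.linear scale (*s) (inv g)"
  proof (rule Vector_Spaces.linear_iff[THEN iffD2], intro conjI allI)
    show "vector_space scale" by (rule vector_space_axioms)
    show "vector_space ((*s) :: complex \<Rightarrow> complex ^ 2 \<Rightarrow> _)" by (rule vec.vector_space_axioms)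
    fix x y k
    have "g (inv g x + inv g y) = x + y"
      using g_f[of x] g_f[of y] by (simp add: g_def flip: comb_add)
    then show "inv g (x + y) = inv g x + inv g y" by (metis f_g)
    have "g (k *s inv g x) = scale k x"
      using g_f[of x] by (simp add: g_def flip: comb_scale)
    then show "inv g (scale k x) = k *s inv g x" by (metis f_g)
  qed
  moreover have "inv g (x \<cdot> y) = J_mult l (inv g x) (inv g y)" for x y
    by (metis f_g g_f g_mult)
  ultimately show ?thesis
    using \<open>bij g\<close> bij_imp_bij_inv
    unfolding isomorphic_algebras_def algebra_isomorphism_def by blast
qed

abbreviation iso :: "J_label \<Rightarrow> bool" where
  "iso l \<equiv> isomorphic_algebras scale mul (*s) (J_mult l)"

end

section \<open>A line stable under squaring\<close>

lemma cubic_root: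
  fixes c0 c1 c2 c3 :: complex
  assumes "c3 \<noteq> 0"
  obtains t where "c0 + c1 * t + c2 * t^2 + c3 * t^3 = 0"
proof -
  have "\<not> constant (poly [:c0, c1, c2, c3:])"
    using assms by (simp add: constant_degree)
  then obtain t where "poly [:c0, c1, c2, c3:] t = 0"
    using fundamental_theorem_of_algebra by blast
  then show thesis
    by (intro that[of t]) (simp add: algebra_simps power2_eq_square power3_eq_cube)
qed

context pre_jordan_algebra
begin

text \<open>The vector \<open>u + t v\<close> is parallel to its square iff \<open>t\<close> is a root of a cubic whose leading coefficient
  is the coefficient of \<open>u\<close> in \<open>v \<cdot> v\<close>.  If that coefficient vanishes, \<open>v\<close> itself is parallel to its
  square.\<close>

lemma square_eigenline:
  assumes "ordered_basis u v"
  shows "\<exists>e w c. ordered_basis e w \<and> e \<cdot> e = scale c e"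
proof -
  obtain a1 b1 a2 b2 a3 b3 a4 b4 where T: "table u v a1 b1 a2 b2 a3 b3 a4 b4"
    using ex_table[OF assms] by blast
  have vv: "v \<cdot> v = comb u v a4 b4" using T by (simp add: table_def)
  show ?thesis
  proof (cases "a4 = 0")
    case True
    have "ordered_basis v u"
      using ordered_basis_change[OF assms, of 0 0 1 1] by (simp add: comb_unit)
    moreover have "v \<cdot> v = scale b4 v" using vv True by (simp add: comb_def)
    ultimately show ?thesis by blast
  next
    case False
    then obtain t where t: "- b1 + (a1 - b2 - b3) * t + (a2 + a3 - b4) * t^2 + a4 * t^3 = 0"
      by (rule cubic_root)
    let ?e = "comb u v 1 t"
    have "ordered_basis ?e v"
      using ordered_basis_change[OF assms, of 1 1 t 0] by (simp add: comb_unit)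
    moreover have "?e \<cdot> ?e = scale (a1 + t * (a2 + a3) + t^2 * a4) ?e"
      unfolding mul_comb[OF T] comb_scale comb_eq_iff[OF assms]
      using t by (auto simp: algebra_simps power2_eq_square power3_eq_cube)
    ultimately show ?thesis by blast
  qed
qed

lemma rescale_idempotent:
  assumes "ordered_basis e w" "e \<cdot> e = scale c e" "c \<noteq> 0"
  shows "\<exists>e' w'. ordered_basis e' w' \<and> e' \<cdot> e' = e'"
proof -
  let ?e = "scale (1 / c) e"
  have "?e \<cdot> ?e = ?e" using assms(2,3) by (simp add: mul_bilinear)
  moreover have "ordered_basis ?e w"
    using ordered_basis_change[OF assms(1), of "1/c" 1 0 0] assms(3) by (simp add: comb_def)
  ultimately show ?thesis by blast
qed

section \<open>Algebras with an idempotent\<close>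

text \<open>With \<open>x = y = z = e\<close> the first identity reads \<open>6 L\<^sup>2 = 2 L\<^sup>3 + 4 L\<close> for the left multiplication \<open>L\<close> by
  \<open>e\<close>.  Applied to \<open>w\<close> it restricts the eigenvalue \<open>b\<close> and excludes a Jordan block at \<open>b = 1\<close>; for
  \<open>b \<noteq> 1\<close> the off-diagonal entry \<open>a\<close> is removed by adding a multiple of \<open>e\<close> to \<open>w\<close>.\<close>

lemma left_eigenbasis:
  assumes basis: "ordered_basis e w" and idem: "e \<cdot> e = e"
  shows "\<exists>w' b c d p q. b \<in> {0, 1, 2} \<and> table e w' 1 0 0 b c d p q"
proof -
  obtain a b where ew: "e \<cdot> w = comb e w a b"
    using basis unfolding ordered_basis_def by blast
  obtain c0 d0 p0 q0 where T: "table e w 1 0 a b c0 d0 p0 q0"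
    using ex_table[OF basis] basis idem ew unfolding table_def by (metis comb_unit(1))
  have "(a = 0 \<or> b = 0 \<or> b = 2) \<and> 6 * (b * b) = 2 * (b * (b * b)) + 4 * b"
    using pre_jordan1[of "comb e w 1 0" "comb e w 1 0" "comb e w 1 0" "comb e w 0 1"]
    by (simp add: circ_def mul_comb[OF T] comb_add comb_eq_iff[OF basis])
  moreover from this have "b * (b - 1) * (b - 2) = 0" by algebra
  ultimately have b: "b \<in> {0, 1, 2}" "b = 1 \<Longrightarrow> a = 0" by auto
  define w' where "w' = comb e w (if b = 1 then 0 else a / (b - 1)) 1"
  have basis': "ordered_basis e w'"
    using ordered_basis_change[OF basis, of 1 1 0] by (simp add: w'_def comb_unit)
  have "comb e w 1 0 \<cdot> w' = scale b w'"
    unfolding w'_def mul_comb[OF T] comb_scale comb_eq_iff[OF basis] using b(2)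
    by (auto simp: divide_simps) (simp add: algebra_simps)
  then have "e \<cdot> w' = comb e w' 0 b" by (simp add: comb_unit) (simp add: comb_def)
  moreover obtain c d where "w' \<cdot> e = comb e w' c d"
    using basis' unfolding ordered_basis_def by blast
  moreover obtain p q where "w' \<cdot> w' = comb e w' p q"
    using basis' unfolding ordered_basis_def by blast
  moreover have "e \<cdot> e = comb e w' 1 0" by (simp add: idem comb_unit)
  ultimately show ?thesis using b basis' unfolding table_def by blast
qed

text \<open>Comparing the coefficients of \<open>w\<close> in the identities for \<open>x = y = u = e\<close> and \<open>z = w\<close> restricts the
  coefficient \<open>d\<close> of \<open>w\<close> in \<open>w \<cdot> e\<close>.\<close>

lemma peirce_types:
  assumes T: "table e w 1 0 0 b c d p q" and b: "b \<in> {0, 1, 2}"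
  shows "(b, d) \<in> {(0, 0), (0, 1), (1, 0), (1, -1), (1, 1), (2, 0), (2, -1)}"
proof -
  let ?e = "comb e w 1 0" and ?w = "comb e w 0 1"
  note ev = circ_def mul_comb[OF T] comb_add comb_eq_iff[OF table_basis[OF T]]
  have "d * (1 - 2 * d + d^2 + 2 * d * b - 4 * b + 2 * b^2) = 0"
    using pre_jordan1[of ?e ?e ?w ?e] by (simp add: ev) algebra
  moreover have "d * (d - 1) * (d + 1) = 0"
    using pre_jordan2[of ?e ?e ?w ?e] by (simp add: ev) algebra
  then have "d = 0 \<or> d = 1 \<or> d = -1" by (auto simp: eq_neg_iff_add_eq_0)
  ultimately show ?thesis using b by auto
qed

text \<open>For each pair \<open>(b, d)\<close> it remains to determine \<open>w \<cdot> e = c e + d w\<close> and \<open>w \<cdot> w = p e + q w\<close>.  The quadruple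
  of basis vectors in each use of an identity is one whose coefficients isolate the constant in
  question.\<close>

context
  fixes e w b c d p q
  assumes T: "table e w 1 0 0 b c d p q"
begin

private abbreviation (input) "E \<equiv> comb e w 1 0"
private abbreviation (input) "W \<equiv> comb e w 0 1"

private lemmas ev = circ_def mul_comb[OF T] comb_add comb_eq_iff[OF table_basis[OF T]]

text \<open>Rewriting with these rules verifies the multiplication table of a basis given by its coordinates with
  respect to \<open>e, w\<close>.\<close>

private lemmas change =
  table_def ordered_basis_change[OF table_basis[OF T]] ev comb_comb axis_2

text \<open>If \<open>c \<noteq> 0\<close>, then \<open>w / q\<close> acts on \<open>e\<close> by \<open>2\<close> from the left while \<open>e\<close> acts on \<open>w\<close> by \<open>0\<close>, so \<open>w / q - e\<close> is a
  left unit; it is the first basis vector of \<open>J12\<close>, and \<open>e\<close> is the second.\<close>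

lemma peirce_0_0:
  assumes "b = 0" "d = 0"
  shows "iso J11 \<or> iso J31 \<or> iso J12"
proof -
  have p: "p = 0" using pre_jordan1[of E E W W] assms by (simp add: ev)
  have c: "c = 0 \<or> c = 2 * q"
    using pre_jordan1[of E W W E] assms p by (auto simp: ev)
  consider "c = 0" "q = 0" | "c = 0" "q \<noteq> 0" | "c = 2 * q" "q \<noteq> 0"
    using c by (cases "q = 0") auto
  then show ?thesis
  proof cases
    case 1
    then have "iso J31"
      using assms p
      by (intro isomorphic_if_table[of "comb e w 1 0" "comb e w 0 1"])
        (simp_all add: change)
    then show ?thesis by blast
  next
    case 2
    then have "iso J11"
      using assms p
      by (intro isomorphic_if_table[of "comb e w 1 0" "comb e w 0 (1 / q)"])
        (simp_all add: change)
    then show ?thesis by blast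
  next
    case 3
    then have "iso J12"
      using assms p
      by (intro isomorphic_if_table[of "comb e w (- 1) (1 / q)" "comb e w 1 0"])
        (simp_all add: change)
    then show ?thesis by blast
  qed
qed

lemma peirce_0_1:
  assumes "b = 0" "d = 1"
  shows "iso J41"
proof -
  have q: "q = 0" using pre_jordan1[of E E W W] assms by (simp add: ev)
  have c: "c = 0" using pre_jordan2[of W E W E] assms by (simp add: ev)
  have p: "p = 0" using pre_jordan1[of E W W W] assms q by (simp add: ev)
  show ?thesis
    using assms q c p
    by (intro isomorphic_if_table[of "comb e w 1 0" "comb e w 0 1"]) (simp_all add: change)
qed

text \<open>Here \<open>e\<close> is a left unit, so \<open>w\<close> may be replaced by \<open>w - c e\<close>, which is annihilated by right
  multiplication by \<open>e\<close>.\<close>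

lemma peirce_1_0:
  assumes "b = 1" "d = 0"
  shows "iso J42"
proof -
  have "p = 0" "q = c" using pre_jordan1[of E E W W] assms by (auto simp: ev)
  then show ?thesis
    using assms
    by (intro isomorphic_if_table[of "comb e w 1 0" "comb e w (- c) 1"]) (simp_all add: change)
qed

text \<open>Since \<open>e\<close> is a left unit and right multiplication by \<open>e\<close> has the eigenvalues \<open>1\<close> and \<open>-1\<close>, the vector
  \<open>w - (c / 2) e\<close> is an eigenvector for \<open>-1\<close>; its square is \<open>q\<close> times itself.\<close>

lemma peirce_1_minus1:
  assumes "b = 1" "d = -1"
  shows "iso J32 \<or> iso J12"
proof -
  have p: "p = c * (c - 2 * q) / 4" using pre_jordan1[of E W W E] assms by (simp add: ev) algebra
  show ?thesis
  proof (cases "q = 0")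
    case True
    then have "iso J32"
      using assms
      by (intro isomorphic_if_table[of "comb e w 1 0" "comb e w (- c / 2) 1"])
        (simp_all add: change p field_simps)
    then show ?thesis by blast
  next
    case False
    then have "iso J12"
      using assms
      by (intro isomorphic_if_table[of "comb e w 1 0" "comb e w (- c / (2 * q)) (1 / q)"])
        (simp_all add: change p field_simps)
    then show ?thesis by blast
  qed
qed

text \<open>The algebra is commutative with unit \<open>e\<close>, hence the quotient of the polynomial ring in \<open>w\<close> by
  \<open>w\<^sup>2 - q w - p\<close>.  A double root gives \<open>J21\<close>; two distinct roots give the product of two fields, with the
  Lagrange interpolation polynomials as orthogonal idempotents.\<close>

lemma peirce_1_1:
  assumes "b = 1" "d = 1"
  shows "iso J11 \<or> iso J21"
proof -
  have c: "c = 0" using pre_jordan1[of E E W E] assms by (simp add: ev)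
  define r where "r = csqrt (q^2 + 4 * p)"
  have r: "r^2 = q^2 + 4 * p" by (simp add: r_def)
  show ?thesis
  proof (cases "r = 0")
    case True
    then have "iso J21"
      using assms c r
      by (intro isomorphic_if_table[of "comb e w 1 0" "comb e w (- q / 2) 1"])
        (simp_all add: change field_simps power2_eq_square)
    then show ?thesis by blast
  next
    case False
    have p: "p = (r^2 - q^2) / 4" using r by simp
    have "iso J11"
      using assms c False
      by (intro isomorphic_if_table[of "comb e w ((r - q) / (2 * r)) (1 / r)"
            "comb e w ((r + q) / (2 * r)) (- 1 / r)"])
        (simp_all add: change p field_simps power2_eq_square)
    then show ?thesis by blast
  qed
qed

text \<open>If \<open>q \<noteq> 0\<close>, both \<open>w / q\<close> and \<open>e - w / q\<close> are idempotent, and the latter is the left unit of \<open>J12\<close>.\<close>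

lemma peirce_2_0:
  assumes "b = 2" "d = 0"
  shows "iso J22 \<or> iso J12"
proof -
  have c: "c = 0" using pre_jordan1[of E E W E] assms by (simp add: ev)
  have p: "p = 0" using pre_jordan1[of E E W W] assms c by (simp add: ev)
  show ?thesis
  proof (cases "q = 0")
    case True
    then have "iso J22"
      using assms c p
      by (intro isomorphic_if_table[of "comb e w 1 0" "comb e w 0 1"]) (simp_all add: change)
    then show ?thesis by blast
  next
    case False
    then have "iso J12"
      using assms c p
      by (intro isomorphic_if_table[of "comb e w 1 (- 1 / q)" "comb e w 0 (1 / q)"])
        (simp_all add: change field_simps)
    then show ?thesis by blast
  qed
qed

lemma peirce_2_minus1:
  assumes "b = 2" "d = -1"
  shows "iso J43"
proof -
  have q: "q = 0" using pre_jordan2[of E W W E] assms by (simp add: ev)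
  have c: "c = 0" using pre_jordan1[of E E W W] assms q by (simp add: ev)
  have p: "p = 0" using pre_jordan1[of E W W W] assms q c by (simp add: ev)
  show ?thesis
    using assms q c p
    by (intro isomorphic_if_table[of "comb e w 1 0" "comb e w 0 1"]) (simp_all add: change)
qed

end

lemma isomorphic_if_idempotent:
  assumes "ordered_basis e w" and idem: "e \<cdot> e = e"
  shows "\<exists>l. iso l"
proof -
  obtain w' b c d p q where b: "b \<in> {0, 1, 2}" and T: "table e w' 1 0 0 b c d p q"
    using left_eigenbasis[OF assms] by blast
  show ?thesis
    using peirce_types[OF T b] peirce_0_0[OF T] peirce_0_1[OF T] peirce_1_0[OF T] peirce_1_1[OF T]
      peirce_1_minus1[OF T] peirce_2_0[OF T] peirce_2_minus1[OF T]
    by auto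
qed

section \<open>A vector of square zero\<close>

text \<open>The identities force \<open>b = d = 0\<close>, so right and left multiplication by \<open>w\<close> preserve the line of \<open>e\<close>.  If
  \<open>q \<noteq> 0\<close>, the equation \<open>(w + s e)\<^sup>2 = q (w + s e)\<close> is linear in \<open>s\<close> and can fail to be solvable only
  when \<open>q = a + c\<close> and \<open>p \<noteq> 0\<close>, which the identities exclude.\<close>

lemma square_zero_dichotomy:
  assumes Bas: "ordered_basis e w" and nil: "e \<cdot> e = 0"
  shows "(\<exists>e' w'. ordered_basis e' w' \<and> e' \<cdot> e' = e') \<or> iso J51 \<or> iso J61"
proof -
  let ?e = "comb e w 1 0" and ?w = "comb e w 0 1"
  note ev = circ_def comb_add comb_eq_iff[OF Bas]
  note change = table_def ordered_basis_change[OF Bas] ev comb_comb axis_2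
  obtain a b c d p q where T0: "table e w 0 0 a b c d p q"
    using ex_table[OF Bas] nil unfolding table_def by (metis comb_unit(3))
  have b: "b = 0"
    using pre_jordan1[of ?e ?e ?e ?w] by (auto simp: ev mul_comb[OF T0])
  have d: "d = 0"
    using pre_jordan1[of ?e ?e ?w ?e] by (auto simp: ev mul_comb[OF T0] b)
  have T: "table e w 0 0 a 0 c 0 p q" using T0 b d by simp
  have a3: "a * (a^2 - q^2) = 0"
    using pre_jordan2[of ?e ?w ?w ?w] by (simp add: ev mul_comb[OF T]) algebra
  show ?thesis
  proof (cases "q = 0")
    case False
    have p: "p = 0" if q: "q = a + c"
    proof (rule ccontr)
      assume "p \<noteq> 0"
      have "p * (2 * c^2 - 4 * c * a - 4 * c * q + 2 * a^2 + 4 * a * q) = 0"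
        using pre_jordan2[of ?w ?w ?w ?w] by (simp add: ev mul_comb[OF T]) algebra
      then have "2 * c^2 - 4 * c * a - 4 * c * q + 2 * a^2 + 4 * a * q = 0"
        using \<open>p \<noteq> 0\<close> by simp
      then have q2: "q^2 = 4 * a^2" using q by algebra
      then have "a = 0" using a3 by (auto simp: power2_eq_square)
      then show False using q2 False by simp
    qed
    define s where "s = (if q = a + c then 0 else p / (q - a - c))"
    have "s * (q - a - c) = p"
      using p by (auto simp: s_def)
    then have s: "s * (a + c) + p = q * s" by (simp add: algebra_simps)
    have "comb e w s 1 \<cdot> comb e w s 1 = scale q (comb e w s 1)"
      unfolding mul_comb[OF T] comb_scale comb_eq_iff[OF Bas] using s by (simp add: algebra_simps)
    moreover have "ordered_basis (comb e w s 1) e"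
      using ordered_basis_change[OF Bas, of s 0 1 1] by (simp add: comb_unit)
    ultimately show ?thesis using rescale_idempotent False by blast
  next
    case q: True
    have a: "a = 0" using a3 q by simp
    have c: "c = 0" using pre_jordan1[of ?w ?w ?w ?e] by (auto simp: ev mul_comb[OF T] q a)
    show ?thesis
    proof (cases "p = 0")
      case True
      then have "iso J61"
        using q a c
        by (intro isomorphic_if_table[of "comb e w 1 0" "comb e w 0 1"])
          (simp_all add: change mul_comb[OF T])
      then show ?thesis by blast
    next
      case False
      then have "iso J51"
        using q a c
        by (intro isomorphic_if_table[of "comb e w 0 1" "comb e w p 0"])
          (simp_all add: change mul_comb[OF T])
      then show ?thesis by blast
    qed
  qed
qed

lemma classification:
  assumes "dim UNIV = 2"
  shows "\<exists>l. iso l"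
proof -
  obtain u v where "ordered_basis u v" using ex_ordered_basis[OF assms] by blast
  then obtain e w c where B: "ordered_basis e w" and c: "e \<cdot> e = scale c e"
    using square_eigenline by blast
  show ?thesis
  proof (cases "c = 0")
    case True
    then show ?thesis
      using square_zero_dichotomy[OF B] c isomorphic_if_idempotent by auto
  next
    case False
    then show ?thesis
      using rescale_idempotent[OF B c] isomorphic_if_idempotent by blast
  qed
qed

end

section \<open>The classification\<close>

theorem theorem3p9:
  shows
    "(\<forall>l. pre_jordan_algebra (*s) (J_mult l)) \<and>
     (\<forall>(scale :: complex \<Rightarrow> 'a::ab_group_add \<Rightarrow> 'a) mul.
        pre_jordan_algebra scale mul \<and> vector_space.dim scale UNIV = 2 \<longrightarrow>
        (\<exists>l. isomorphic_algebras scale mul (*s) (J_mult l))) \<and>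
     (\<forall>l l'. l \<noteq> l' \<longrightarrow> \<not> isomorphic_algebras (*s) (J_mult l) (*s) (J_mult l')) \<and>
     (\<forall>l\<in>{J11, J21, J31, J51, J61}. abel_semigroup (J_mult l)) \<and>
     (\<forall>l\<in>{J41, J42}. semigroup (J_mult l))"
proof (intro conjI allI ballI impI)
  show "pre_jordan_algebra (*s) (J_mult l)" for l
    by (rule pre_jordan_J)
next
  fix scale :: "complex \<Rightarrow> 'a \<Rightarrow> 'a" and mul
  assume "pre_jordan_algebra scale mul \<and> vector_space.dim scale UNIV = 2"
  then show "\<exists>l. isomorphic_algebras scale mul (*s) (J_mult l)"
    by (blast intro: pre_jordan_algebra.classification)
next
  show "\<not> isomorphic_algebras (*s) (J_mult l) (*s) (J_mult l')" if "l \<noteq> l'" for l l'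
    using that by (rule not_isomorphic_J)
next
  show "abel_semigroup (J_mult l)" if "l \<in> {J11, J21, J31, J51, J61}" for l
    using that by (rule commutative_associative_J)
next
  show "semigroup (J_mult l)" if "l \<in> {J41, J42}" for l
    using that by (intro associative_J) auto
qed

end
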